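(* Let $G$ be a compact Lie group and let $f,g\colon X\to Y$ and $f',g'\colon X'\to Y'$ be $G$-maps between $G$-spaces. If there exist $G$-homotopy equivalences $\alpha\colon Y\to Y'$ and $\beta\colon X'\to X$ such that $\alpha\circ f\circ\beta\simeq_G f'$ and $\alpha\circ g\circ\beta\simeq_G g'$, then $$D_G(f,g)=D_G(f',g').$$
   Context: $\simeq_G$ denotes $G$-homotopy. Equivariant homotopic distance: for $G$-maps $f,g\colon X\to Y$, $D_G(f,g)$ is the least integer $n\ge 0$ such that $X$ has an open cover $\{U_0,\dots,U_n\}$ by $G$-invariant open sets with $f|_{U_i}\simeq_G g|_{U_i}$ for all $0\le i\le n$; it is $\infty$ if no such $n$ exists. *)

theory Defs
  imports "HOL-Analysis.Analysis" "HOL-Algebra.Group_Action"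
begin

section \<open>Smooth maps between open subsets of Euclidean spaces\<close>

text \<open>
  The model spaces are the topologies \<^term>\<open>Euclidean_space n\<close> on
  sequences that vanish from index \<open>n\<close> on. The type class \<^class>\<open>euclidean_space\<close> has no member of
  dimension 0, and finite groups are Lie groups of dimension 0.
\<close>

definition partial_deriv :: "nat \<Rightarrow> ((nat \<Rightarrow> real) \<Rightarrow> real) \<Rightarrow> (nat \<Rightarrow> real) \<Rightarrow> real" where
  "partial_deriv i f x = deriv (\<lambda>t. f (x(i := t))) (x i)"

text \<open>
  Class \<open>C\<^sup>k\<close> on an open set \<open>U\<close> of the space of dimension \<open>n\<close>: the partial derivatives up to
  order \<open>k\<close> exist and are continuous on \<open>U\<close>.
\<close>

fun Ck_on :: "nat \<Rightarrow> nat \<Rightarrow> (nat \<Rightarrow> real) set \<Rightarrow> ((nat \<Rightarrow> real) \<Rightarrow> real) \<Rightarrow> bool" where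
  "Ck_on 0 n U f \<longleftrightarrow> continuous_map (subtopology (Euclidean_space n) U) euclideanreal f"
| "Ck_on (Suc k) n U f \<longleftrightarrow>
     continuous_map (subtopology (Euclidean_space n) U) euclideanreal f \<and>
     (\<forall>i<n. (\<forall>x\<in>U. (\<lambda>t. f (x(i := t))) field_differentiable at (x i)) \<and>
            Ck_on k n U (partial_deriv i f))"

definition smooth_map_on ::
  "nat \<Rightarrow> nat \<Rightarrow> (nat \<Rightarrow> real) set \<Rightarrow> ((nat \<Rightarrow> real) \<Rightarrow> (nat \<Rightarrow> real)) \<Rightarrow> bool" where
  "smooth_map_on n m U F \<longleftrightarrow>
     openin (Euclidean_space n) U \<and> F \<in> U \<rightarrow> topspace (Euclidean_space m) \<and>
     (\<forall>j<m. \<forall>k. Ck_on k n U (\<lambda>x. F x j))"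

section \<open>Compact Lie groups\<close>

definition is_chart :: "nat \<Rightarrow> 'g topology \<Rightarrow> 'g set \<Rightarrow> ('g \<Rightarrow> nat \<Rightarrow> real) \<Rightarrow> bool" where
  "is_chart n T V \<phi> \<longleftrightarrow>
     openin T V \<and> openin (Euclidean_space n) (\<phi> ` V) \<and>
     homeomorphic_map (subtopology T V) (subtopology (Euclidean_space n) (\<phi> ` V)) \<phi>"

definition smooth_atlas ::
  "nat \<Rightarrow> 'g topology \<Rightarrow> ('g set \<times> ('g \<Rightarrow> nat \<Rightarrow> real)) set \<Rightarrow> bool" where
  "smooth_atlas n T A \<longleftrightarrow>
     (\<forall>(V, \<phi>)\<in>A. is_chart n T V \<phi>) \<and>
     \<Union> (fst ` A) = topspace T \<and>
     (\<forall>(V, \<phi>)\<in>A. \<forall>(W, \<psi>)\<in>A. smooth_map_on n n (\<phi> ` (V \<inter> W)) (\<lambda>x. \<psi> (inv_into V \<phi> x)))"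

text \<open>
  The two projections of a point of \<^term>\<open>Euclidean_space (n + n)\<close>, read as a pair of points
  of \<^term>\<open>Euclidean_space n\<close>.
\<close>

definition proj_fst :: "nat \<Rightarrow> (nat \<Rightarrow> real) \<Rightarrow> nat \<Rightarrow> real" where
  "proj_fst n z = (\<lambda>i. if i < n then z i else 0)"

definition proj_snd :: "nat \<Rightarrow> (nat \<Rightarrow> real) \<Rightarrow> nat \<Rightarrow> real" where
  "proj_snd n z = (\<lambda>i. if i < n then z (n + i) else 0)"

definition smooth_mult ::
  "nat \<Rightarrow> ('g set \<times> ('g \<Rightarrow> nat \<Rightarrow> real)) set \<Rightarrow> ('g, 'm) monoid_scheme \<Rightarrow> 'g topology \<Rightarrow> bool" where
  "smooth_mult n A G T \<longleftrightarrow>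
     continuous_map (prod_topology T T) T (\<lambda>(a, b). a \<otimes>\<^bsub>G\<^esub> b) \<and>
     (\<forall>(V, \<phi>)\<in>A. \<forall>(W, \<psi>)\<in>A. \<forall>(Z, \<theta>)\<in>A.
        smooth_map_on (n + n) n
          {z \<in> topspace (Euclidean_space (n + n)).
             proj_fst n z \<in> \<phi> ` V \<and> proj_snd n z \<in> \<psi> ` W \<and>
             inv_into V \<phi> (proj_fst n z) \<otimes>\<^bsub>G\<^esub> inv_into W \<psi> (proj_snd n z) \<in> Z}
          (\<lambda>z. \<theta> (inv_into V \<phi> (proj_fst n z) \<otimes>\<^bsub>G\<^esub> inv_into W \<psi> (proj_snd n z))))"

definition smooth_inverse ::
  "nat \<Rightarrow> ('g set \<times> ('g \<Rightarrow> nat \<Rightarrow> real)) set \<Rightarrow> ('g, 'm) monoid_scheme \<Rightarrow> 'g topology \<Rightarrow> bool" where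
  "smooth_inverse n A G T \<longleftrightarrow>
     continuous_map T T (\<lambda>a. inv\<^bsub>G\<^esub> a) \<and>
     (\<forall>(V, \<phi>)\<in>A. \<forall>(W, \<psi>)\<in>A.
        smooth_map_on n n
          {x \<in> \<phi> ` V. inv\<^bsub>G\<^esub> (inv_into V \<phi> x) \<in> W}
          (\<lambda>x. \<psi> (inv\<^bsub>G\<^esub> (inv_into V \<phi> x))))"

definition compact_Lie_group :: "('g, 'm) monoid_scheme \<Rightarrow> 'g topology \<Rightarrow> bool" where
  "compact_Lie_group G T \<longleftrightarrow>
     group G \<and> topspace T = carrier G \<and>
     Hausdorff_space T \<and> second_countable T \<and> compact_space T \<and>
     (\<exists>n A. smooth_atlas n T A \<and> smooth_mult n A G T \<and> smooth_inverse n A G T)"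

section \<open>\<open>G\<close>-spaces, \<open>G\<close>-maps and \<open>G\<close>-homotopy\<close>

definition G_space ::
  "('g, 'm) monoid_scheme \<Rightarrow> 'g topology \<Rightarrow> 'x topology \<Rightarrow> ('g \<Rightarrow> 'x \<Rightarrow> 'x) \<Rightarrow> bool" where
  "G_space G T X \<rho> \<longleftrightarrow>
     group_action G (topspace X) \<rho> \<and>
     continuous_map (prod_topology T X) X (\<lambda>(g, x). \<rho> g x)"

definition G_invariant :: "('g, 'm) monoid_scheme \<Rightarrow> ('g \<Rightarrow> 'x \<Rightarrow> 'x) \<Rightarrow> 'x set \<Rightarrow> bool" where
  "G_invariant G \<rho> U \<longleftrightarrow> (\<forall>g\<in>carrier G. \<forall>x\<in>U. \<rho> g x \<in> U)"

definition equivariant_on ::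
  "('g, 'm) monoid_scheme \<Rightarrow> ('g \<Rightarrow> 'x \<Rightarrow> 'x) \<Rightarrow> ('g \<Rightarrow> 'y \<Rightarrow> 'y) \<Rightarrow> 'x set \<Rightarrow> ('x \<Rightarrow> 'y) \<Rightarrow> bool" where
  "equivariant_on G \<rho> \<sigma> S f \<longleftrightarrow> (\<forall>g\<in>carrier G. \<forall>x\<in>S. f (\<rho> g x) = \<sigma> g (f x))"

definition G_map ::
  "('g, 'm) monoid_scheme \<Rightarrow> 'x topology \<Rightarrow> ('g \<Rightarrow> 'x \<Rightarrow> 'x) \<Rightarrow> 'y topology \<Rightarrow> ('g \<Rightarrow> 'y \<Rightarrow> 'y) \<Rightarrow>
   ('x \<Rightarrow> 'y) \<Rightarrow> bool" where
  "G_map G X \<rho> Y \<sigma> f \<longleftrightarrow> continuous_map X Y f \<and> equivariant_on G \<rho> \<sigma> (topspace X) f"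

text \<open>
  A homotopy all of whose stages are equivariant is the same as an equivariant map from the
  cylinder, with \<open>G\<close> acting trivially on the interval.
\<close>

definition G_homotopic ::
  "('g, 'm) monoid_scheme \<Rightarrow> 'x topology \<Rightarrow> ('g \<Rightarrow> 'x \<Rightarrow> 'x) \<Rightarrow> 'y topology \<Rightarrow> ('g \<Rightarrow> 'y \<Rightarrow> 'y) \<Rightarrow>
   ('x \<Rightarrow> 'y) \<Rightarrow> ('x \<Rightarrow> 'y) \<Rightarrow> bool" where
  "G_homotopic G X \<rho> Y \<sigma> = homotopic_with (equivariant_on G \<rho> \<sigma> (topspace X)) X Y"

definition G_homotopy_equivalence ::
  "('g, 'm) monoid_scheme \<Rightarrow> 'x topology \<Rightarrow> ('g \<Rightarrow> 'x \<Rightarrow> 'x) \<Rightarrow> 'y topology \<Rightarrow> ('g \<Rightarrow> 'y \<Rightarrow> 'y) \<Rightarrow>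
   ('x \<Rightarrow> 'y) \<Rightarrow> bool" where
  "G_homotopy_equivalence G X \<rho> Y \<sigma> h \<longleftrightarrow>
     G_map G X \<rho> Y \<sigma> h \<and>
     (\<exists>k. G_map G Y \<sigma> X \<rho> k \<and>
          G_homotopic G X \<rho> X \<rho> (k \<circ> h) id \<and> G_homotopic G Y \<sigma> Y \<sigma> (h \<circ> k) id)"

section \<open>Equivariant homotopic distance\<close>

text \<open>
  The infimum of the empty set in \<^typ>\<open>enat\<close> is \<^term>\<open>\<infinity>\<close>. An invariant open set carries the
  subspace topology and the restricted action.
\<close>

definition G_homotopic_distance ::
  "('g, 'm) monoid_scheme \<Rightarrow> 'x topology \<Rightarrow> ('g \<Rightarrow> 'x \<Rightarrow> 'x) \<Rightarrow> 'y topology \<Rightarrow> ('g \<Rightarrow> 'y \<Rightarrow> 'y) \<Rightarrow>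
   ('x \<Rightarrow> 'y) \<Rightarrow> ('x \<Rightarrow> 'y) \<Rightarrow> enat" where
  "G_homotopic_distance G X \<rho> Y \<sigma> f g =
     Inf {enat n | n. \<exists>U :: nat \<Rightarrow> 'x set.
        (\<Union>i\<le>n. U i) = topspace X \<and>
        (\<forall>i\<le>n. openin X (U i) \<and> G_invariant G \<rho> (U i) \<and>
               G_homotopic G (subtopology X (U i)) \<rho> Y \<sigma> f g)}"

end

theory Submission
  imports Defs
begin

text \<open>
  Both inequalities are instances of one monotonicity principle. If \<open>f' \<simeq> a f b\<close> and
  \<open>g' \<simeq> a g b\<close> for some \<open>G\<close>-maps \<open>a\<close>, \<open>b\<close>, then pulling a cover back along \<open>b\<close> turns a witness
  for the distance of \<open>f\<close> and \<open>g\<close> into a witness of the same size for \<open>f'\<close> and \<open>g'\<close>, because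
  a \<open>G\<close>-homotopy over \<open>U\<close> composes with \<open>b\<close> and \<open>a\<close> to one over the preimage of \<open>U\<close>
  (\<open>G_homotopic_distance_compose_le\<close>). Taking \<open>a = \<alpha>\<close> and \<open>b = \<beta>\<close> gives one inequality. For the
  other, let \<open>k\<close> and \<open>l\<close> be homotopy inverses of \<open>\<alpha>\<close> and \<open>\<beta>\<close>: then
  \<open>k f' l \<simeq> k \<alpha> f \<beta> l \<simeq> f\<close>, and likewise for \<open>g\<close> (\<open>G_homotopic_conjugate_inverse\<close>), so the
  principle applies with \<open>a = k\<close> and \<open>b = l\<close>.
\<close>

lemma G_space_action_closed:
  assumes "G_space G T X \<rho>" "h \<in> carrier G" "x \<in> topspace X"
  shows "\<rho> h x \<in> topspace X"
  using assms(1) group_action.element_image[OF _ assms(2,3) refl]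
  by (simp add: G_space_def)

lemma G_map_in_topspace:
  assumes "G_map G X \<rho> Y \<sigma> f" "x \<in> topspace X"
  shows "f x \<in> topspace Y"
  using assms unfolding G_map_def by (simp add: continuous_map_def Pi_iff)

lemma G_map_compose:
  assumes "G_map G X \<rho> Y \<sigma> f" "G_map G Y \<sigma> Z \<tau> g"
  shows "G_map G X \<rho> Z \<tau> (g \<circ> f)"
  using assms continuous_map_compose[of X Y f Z g] G_map_in_topspace[OF assms(1)]
  by (simp add: G_map_def equivariant_on_def)

lemma G_map_subtopology:
  assumes "G_map G X \<rho> Y \<sigma> f" "f \<in> topspace X \<inter> S \<rightarrow> U"
  shows "G_map G (subtopology X S) \<rho> (subtopology Y U) \<sigma> f"
  using assms continuous_map_from_subtopology[of X Y f S]
  by (simp add: G_map_def equivariant_on_def continuous_map_in_subtopology Pi_iff image_subset_iff)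

lemma G_homotopic_sym:
  "G_homotopic G X \<rho> Y \<sigma> f g \<Longrightarrow> G_homotopic G X \<rho> Y \<sigma> g f"
  unfolding G_homotopic_def by (rule homotopic_with_symD)

lemma G_homotopic_trans:
  "\<lbrakk>G_homotopic G X \<rho> Y \<sigma> f g; G_homotopic G X \<rho> Y \<sigma> g h\<rbrakk> \<Longrightarrow> G_homotopic G X \<rho> Y \<sigma> f h"
  unfolding G_homotopic_def by (rule homotopic_with_trans)

text \<open>
  Every stage of the homotopy is continuous, so it lands in \<^term>\<open>topspace Y\<close>, where \<open>a\<close> is
  equivariant. The stages are therefore recorded as continuous as well as equivariant before
  \<open>a\<close> is applied.
\<close>

lemma G_homotopic_compose_left:
  assumes "G_homotopic G X \<rho> Y \<sigma> f g" "G_map G Y \<sigma> Z \<tau> a"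
  shows "G_homotopic G X \<rho> Z \<tau> (a \<circ> f) (a \<circ> g)"
proof -
  let ?P = "\<lambda>p. continuous_map X Y p \<and> equivariant_on G \<rho> \<sigma> (topspace X) p"
  have "homotopic_with ?P X Y f g"
    using assms(1) unfolding G_homotopic_def by (rule homotopic_with_mono) simp
  then show ?thesis
    unfolding G_homotopic_def
  proof (rule homotopic_with_compose_continuous_map_left)
    show "continuous_map Y Z a"
      using assms(2) by (simp add: G_map_def)
    show "equivariant_on G \<rho> \<tau> (topspace X) (a \<circ> p)" if "?P p" for p
      using G_map_compose[OF _ assms(2), of X \<rho> p] that by (simp add: G_map_def)
  qed
qed

lemma G_homotopic_compose_right:
  assumes "G_homotopic G X \<rho> Y \<sigma> f g" "G_map G W \<tau> X \<rho> b"
  shows "G_homotopic G W \<tau> Y \<sigma> (f \<circ> b) (g \<circ> b)"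
  using assms(1) unfolding G_homotopic_def
proof (rule homotopic_with_compose_continuous_map_right)
  show "continuous_map W X b"
    using assms(2) by (simp add: G_map_def)
  show "equivariant_on G \<tau> \<sigma> (topspace W) (p \<circ> b)"
    if "equivariant_on G \<rho> \<sigma> (topspace X) p" for p
    using that assms(2) G_map_in_topspace[OF assms(2)]
    by (auto simp: G_map_def equivariant_on_def)
qed

lemma G_homotopic_subtopology:
  assumes "G_homotopic G X \<rho> Y \<sigma> f g"
  shows "G_homotopic G (subtopology X S) \<rho> Y \<sigma> f g"
proof -
  have "G_map G (subtopology X S) \<rho> X \<rho> id"
    by (auto simp: G_map_def equivariant_on_def)
  from G_homotopic_compose_right[OF assms this] show ?thesis
    by simp
qed

text \<open>
  Preimages under \<open>b\<close> of invariant open sets are again invariant and open. On such a preimage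
  the homotopies \<open>f' \<simeq> a f b\<close> and \<open>a g b \<simeq> g'\<close>, restricted from all of \<open>X'\<close>, are joined by the
  homotopy \<open>f \<simeq> g\<close> over the original set, composed with \<open>b\<close> and \<open>a\<close>.
\<close>

lemma G_homotopic_distance_compose_le:
  fixes X :: "'x topology"
  assumes X': "G_space G T X' \<rho>'"
    and a: "G_map G Y \<sigma> Y' \<sigma>' a" and b: "G_map G X' \<rho>' X \<rho> b"
    and f': "G_homotopic G X' \<rho>' Y' \<sigma>' (a \<circ> f \<circ> b) f'"
    and g': "G_homotopic G X' \<rho>' Y' \<sigma>' (a \<circ> g \<circ> b) g'"
  shows "G_homotopic_distance G X' \<rho>' Y' \<sigma>' f' g' \<le> G_homotopic_distance G X \<rho> Y \<sigma> f g"
  unfolding G_homotopic_distance_def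
proof (rule Inf_superset_mono, clarify)
  fix n and U :: "nat \<Rightarrow> 'x set"
  assume cover: "(\<Union>i\<le>n. U i) = topspace X"
    and U: "\<forall>i\<le>n. openin X (U i) \<and> G_invariant G \<rho> (U i) \<and>
      G_homotopic G (subtopology X (U i)) \<rho> Y \<sigma> f g"
  define V where "V i = {x \<in> topspace X'. b x \<in> U i}" for i
  have "(\<Union>i\<le>n. V i) = topspace X'"
    using cover G_map_in_topspace[OF b] by (auto simp: V_def)
  moreover have "openin X' (V i)" if "i \<le> n" for i
    using openin_continuous_map_preimage[of X' X b "U i"] b U that
    by (simp add: V_def G_map_def)
  moreover have "G_invariant G \<rho>' (V i)" if "i \<le> n" for i
    using b U that G_space_action_closed[OF X']
    by (auto simp: V_def G_invariant_def G_map_def equivariant_on_def)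
  moreover have "G_homotopic G (subtopology X' (V i)) \<rho>' Y' \<sigma>' f' g'" if "i \<le> n" for i
  proof -
    have bV: "G_map G (subtopology X' (V i)) \<rho>' (subtopology X (U i)) \<rho> b"
      by (rule G_map_subtopology[OF b]) (auto simp: V_def)
    have "G_homotopic G (subtopology X' (V i)) \<rho>' Y' \<sigma>' (a \<circ> f \<circ> b) (a \<circ> g \<circ> b)"
      using U that
      by (intro G_homotopic_compose_right[OF _ bV] G_homotopic_compose_left[OF _ a]) simp
    then show ?thesis
      by (rule G_homotopic_trans[OF G_homotopic_trans[OF
            G_homotopic_sym[OF G_homotopic_subtopology[OF f']]]
            G_homotopic_subtopology[OF g']])
  qed
  ultimately show "\<exists>m. enat n = enat m \<and> (\<exists>V. (\<Union>i\<le>m. V i) = topspace X' \<and>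
      (\<forall>i\<le>m. openin X' (V i) \<and> G_invariant G \<rho>' (V i) \<and>
        G_homotopic G (subtopology X' (V i)) \<rho>' Y' \<sigma>' f' g'))"
    by (intro exI[of _ n] exI[of _ V] conjI refl allI impI) simp_all
qed

text \<open>
  After \<open>f'\<close> is replaced by \<open>\<alpha> f \<beta>\<close>, the outer factor \<open>k \<alpha>\<close> cancels by precomposing its homotopy
  to the identity with \<open>f \<beta> l\<close>, and then \<open>\<beta> l\<close> cancels by postcomposing with \<open>f\<close>.
\<close>

lemma G_homotopic_conjugate_inverse:
  assumes f: "G_map G X \<rho> Y \<sigma> f" and \<beta>: "G_map G X' \<rho>' X \<rho> \<beta>"
    and k: "G_map G Y' \<sigma>' Y \<sigma> k" and l: "G_map G X \<rho> X' \<rho>' l"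
    and k\<alpha>: "G_homotopic G Y \<sigma> Y \<sigma> (k \<circ> \<alpha>) id"
    and \<beta>l: "G_homotopic G X \<rho> X \<rho> (\<beta> \<circ> l) id"
    and f': "G_homotopic G X' \<rho>' Y' \<sigma>' (\<alpha> \<circ> f \<circ> \<beta>) f'"
  shows "G_homotopic G X \<rho> Y \<sigma> (k \<circ> f' \<circ> l) f"
proof -
  have "G_homotopic G X \<rho> Y \<sigma> (k \<circ> f' \<circ> l) (k \<circ> (\<alpha> \<circ> f \<circ> \<beta>) \<circ> l)"
    by (intro G_homotopic_compose_right[OF _ l] G_homotopic_compose_left[OF _ k]
        G_homotopic_sym[OF f'])
  moreover have "G_homotopic G X \<rho> Y \<sigma> (k \<circ> (\<alpha> \<circ> f \<circ> \<beta>) \<circ> l) (f \<circ> (\<beta> \<circ> l))"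
    using G_homotopic_compose_right[OF k\<alpha> G_map_compose[OF G_map_compose[OF l \<beta>] f]]
    by (simp add: o_assoc)
  moreover have "G_homotopic G X \<rho> Y \<sigma> (f \<circ> (\<beta> \<circ> l)) f"
    using G_homotopic_compose_left[OF \<beta>l f] by simp
  ultimately show ?thesis
    by (rule G_homotopic_trans[OF G_homotopic_trans])
qed

theorem corollary4p14:
  fixes G :: "('g, 'm) monoid_scheme" and T :: "'g topology"
    and X :: "'x topology" and Y :: "'y topology"
    and X' :: "'x2 topology" and Y' :: "'y2 topology"
    and \<rho> :: "'g \<Rightarrow> 'x \<Rightarrow> 'x" and \<sigma> :: "'g \<Rightarrow> 'y \<Rightarrow> 'y"
    and \<rho>' :: "'g \<Rightarrow> 'x2 \<Rightarrow> 'x2" and \<sigma>' :: "'g \<Rightarrow> 'y2 \<Rightarrow> 'y2"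
    and f g :: "'x \<Rightarrow> 'y" and f' g' :: "'x2 \<Rightarrow> 'y2"
    and \<alpha> :: "'y \<Rightarrow> 'y2" and \<beta> :: "'x2 \<Rightarrow> 'x"
  assumes "compact_Lie_group G T"
    and "G_space G T X \<rho>" and "G_space G T Y \<sigma>"
    and "G_space G T X' \<rho>'" and "G_space G T Y' \<sigma>'"
    and "G_map G X \<rho> Y \<sigma> f" and "G_map G X \<rho> Y \<sigma> g"
    and "G_map G X' \<rho>' Y' \<sigma>' f'" and "G_map G X' \<rho>' Y' \<sigma>' g'"
    and "G_homotopy_equivalence G Y \<sigma> Y' \<sigma>' \<alpha>"
    and "G_homotopy_equivalence G X' \<rho>' X \<rho> \<beta>"
    and "G_homotopic G X' \<rho>' Y' \<sigma>' (\<alpha> \<circ> f \<circ> \<beta>) f'"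
    and "G_homotopic G X' \<rho>' Y' \<sigma>' (\<alpha> \<circ> g \<circ> \<beta>) g'"
  shows "G_homotopic_distance G X \<rho> Y \<sigma> f g = G_homotopic_distance G X' \<rho>' Y' \<sigma>' f' g'"
proof (rule antisym)
  obtain k where k: "G_map G Y' \<sigma>' Y \<sigma> k" "G_homotopic G Y \<sigma> Y \<sigma> (k \<circ> \<alpha>) id"
    using assms(10) unfolding G_homotopy_equivalence_def by blast
  obtain l where l: "G_map G X \<rho> X' \<rho>' l" "G_homotopic G X \<rho> X \<rho> (\<beta> \<circ> l) id"
    using assms(11) unfolding G_homotopy_equivalence_def by blast
  have \<alpha>: "G_map G Y \<sigma> Y' \<sigma>' \<alpha>" and \<beta>: "G_map G X' \<rho>' X \<rho> \<beta>"
    using assms(10,11) unfolding G_homotopy_equivalence_def by blast+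
  show "G_homotopic_distance G X' \<rho>' Y' \<sigma>' f' g' \<le> G_homotopic_distance G X \<rho> Y \<sigma> f g"
    by (rule G_homotopic_distance_compose_le[OF assms(4) \<alpha> \<beta> assms(12,13)])
  note inverse = G_homotopic_conjugate_inverse[OF _ \<beta> k(1) l(1) k(2) l(2)]
  show "G_homotopic_distance G X \<rho> Y \<sigma> f g \<le> G_homotopic_distance G X' \<rho>' Y' \<sigma>' f' g'"
    by (rule G_homotopic_distance_compose_le[OF assms(2) k(1) l(1)
          inverse[OF assms(6,12)] inverse[OF assms(7,13)]])
qed

end
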